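(* Let $\hat w\in\mathcal F$ and let the strong regularity assumption (stated in the context) hold. Then there exist constants $\Delta_{\max,1}>0$ and $L>0$ such that for all trust-region radii $0<\Delta\le\Delta_{\max,1}$ the inner feasibility iterates $\{w_l\}_{l\in\mathbb N}$ generated from $\hat w$ with radius $\Delta$ (defined in the context) converge towards a point $w^*\in\mathcal F$, and the contraction rate is proportional to $\Delta$, i.e. $$\Vert w_{l+1}-w^*\Vert\le L\,\Delta\,\Vert w_l-w^*\Vert\qquad\text{for all } l\in\mathbb N.$$
   Context: Problem. Decision variables $w=(y,s)\in\mathbb R^{n_w}$ consist of non-slack variables $y\in\mathbb R^{n_y}$ and slack variables $s\in\mathbb R^{n_w-n_y}$; $P_y\in\mathbb R^{n_y\times n_w}$ is the projection matrix with $P_yw=y$. Let $c\in\mathbb R^{n_w}$, $C\in\mathbb R^{n_g\times n_w}$, $b\in\mathbb R^{n_b}$, $A\in\mathbb R^{n_b\times n_w}$ of full row rank $n_b$, and let $g\colon\mathbb R^{n_y}\to\mathbb R^{n_g}$ be differentiable. The nonlinear program is $$\min_{w\in\mathbb R^{n_w}} c^\top w\quad\text{s.t. } Cw+g(P_yw)=0,\ Aw+b\le 0,$$ with feasible set $\mathcal F=\{w\in\mathbb R^{n_w} : Cw+g(P_yw)=0,\ Aw+b\le0\}$. $\Vert\cdot\Vert$ is the Euclidean norm, $\mathcal B(x,\gamma)$ is the closed Euclidean ball of center $x$ and radius $\gamma$, and $\nabla g(y)\in\mathbb R^{n_y\times n_g}$ is the transpose of the Jacobian of $g$ at $y$. Parametric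 linear program. For $\hat w\in\mathcal F$ put $G^\top:=\nabla g(P_y\hat w)^\top P_y$ and, for $w\in\mathbb R^{n_w}$, $$\delta(w,\hat w):=g(P_yw)-g(P_y\hat w)-G^\top(w-\hat w).$$ For $\delta\in\mathbb R^{n_g}$ and $\Delta>0$, $\mathrm{PLP}(\delta;\hat w,\Delta)$ is the linear program $$\min_{w\in\mathbb R^{n_w}} c^\top w\quad\text{s.t. } \delta+Cw+g(P_y\hat w)+G^\top(w-\hat w)=0,\ Aw+b\le0,\ \Vert P_y(w-\hat w)\Vert_\infty\le\Delta,$$ and $w^*_{\mathrm{PLP}}(\delta;\hat w,\Delta)$ denotes its solution. Strong regularity assumption. For all $\hat w\in\mathcal F$ there exist $L_1,L_2,\bar\Delta>0$ such that for all $0<\Delta\le\bar\Delta$ and all $\delta_1,\delta_2\in\mathcal B(0,L_2\Delta)\subset\mathbb R^{n_g}$ (the solutions $w^*_{\mathrm{PLP}}(\delta_i;\hat w,\Delta)$ being understood to be well defined), $$\Vert w^*_{\mathrm{PLP}}(\delta_1;\hat w,\Delta)-w^*_{\mathrm{PLP}}(\delta_2;\hat w,\Delta)\Vert\le L_1\Vert\delta_1-\delta_2\Vert.$$ Inner feasibility iterates. Given $\hat w\in\mathcal F$ and $\Delta>0$, let $\bar w:=w^*_{\mathrm{PLP}}(0;\hat w,\Delta)$ (the solution of the trust-region linear program obtained by linearizing the constraints at $\hat w$). Set $w_0:=\bar w$ and, for $l=0,1,2,\dots$, $\delta_l:=\delta(w_l,\hat w)$ and $w_{l+1}:=w^*_{\mathrm{PLP}}(\delta_l;\hat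 w,\Delta)$ (the iteration is run indefinitely, without stopping tests).
   Formalization: Added hypothesis: near the point P_yŵ, the gradient of g satisfies ‖∇g(y)−∇g(P_yŵ)‖ ≤ K‖y−P_yŵ‖ for some K; with g merely differentiable the rate can be of order √Δ (e.g. g(y)=y₂√|y₂|), so the claim fails. *)

theory Defs
  imports "HOL-Analysis.Analysis"
begin

text \<open>
  The coordinates of \<open>w\<close> are indexed by \<open>'w\<close> and those of \<open>y\<close> by \<open>'y\<close>. An injection
  \<open>\<iota> :: 'y \<Rightarrow> 'w\<close> says which coordinates of \<open>w\<close> are the non-slack ones; the coordinates
  outside its range, possibly none, are the slack variables \<open>s\<close>.
\<close>

definition proj_y :: "('y::finite \<Rightarrow> 'w::finite) \<Rightarrow> real^'w^'y" where
  "proj_y \<iota> = (\<chi> i j. if j = \<iota> i then 1 else 0)"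

definition feasible_set ::
  "('y::finite \<Rightarrow> 'w::finite) \<Rightarrow> real^'w^'g \<Rightarrow> (real^'y \<Rightarrow> real^'g)
    \<Rightarrow> real^'w^'b \<Rightarrow> real^'b \<Rightarrow> (real^'w) set" where
  "feasible_set \<iota> C g A b = {w. C *v w + g (proj_y \<iota> *v w) = 0 \<and> A *v w + b \<le> 0}"

definition grad :: "(real^'y \<Rightarrow> real^'g) \<Rightarrow> real^'y \<Rightarrow> real^'g^'y" where
  "grad g y = transpose (jacobian g (at y))"

definition lin_matrix ::
  "('y::finite \<Rightarrow> 'w::finite) \<Rightarrow> (real^'y \<Rightarrow> real^'g) \<Rightarrow> real^'w \<Rightarrow> real^'w^'g" where
  "lin_matrix \<iota> g w_hat = transpose (grad g (proj_y \<iota> *v w_hat)) ** proj_y \<iota>"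

definition lin_error ::
  "('y::finite \<Rightarrow> 'w::finite) \<Rightarrow> (real^'y \<Rightarrow> real^'g) \<Rightarrow> real^'w \<Rightarrow> real^'w \<Rightarrow> real^'g" where
  "lin_error \<iota> g w w_hat =
    g (proj_y \<iota> *v w) - g (proj_y \<iota> *v w_hat) - lin_matrix \<iota> g w_hat *v (w - w_hat)"

definition plp_feasible ::
  "('y::finite \<Rightarrow> 'w::finite) \<Rightarrow> real^'w^'g \<Rightarrow> (real^'y \<Rightarrow> real^'g)
    \<Rightarrow> real^'w^'b \<Rightarrow> real^'b \<Rightarrow> real^'g \<Rightarrow> real^'w \<Rightarrow> real \<Rightarrow> (real^'w) set" where
  "plp_feasible \<iota> C g A b \<delta> w_hat \<Delta> =
    {w. \<delta> + C *v w + g (proj_y \<iota> *v w_hat) + lin_matrix \<iota> g w_hat *v (w - w_hat) = 0 \<and>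
        A *v w + b \<le> 0 \<and>
        infnorm (proj_y \<iota> *v (w - w_hat)) \<le> \<Delta>}"

definition is_plp_solution ::
  "('y::finite \<Rightarrow> 'w::finite) \<Rightarrow> real^'w \<Rightarrow> real^'w^'g \<Rightarrow> (real^'y \<Rightarrow> real^'g)
    \<Rightarrow> real^'w^'b \<Rightarrow> real^'b \<Rightarrow> real^'g \<Rightarrow> real^'w \<Rightarrow> real \<Rightarrow> real^'w \<Rightarrow> bool" where
  "is_plp_solution \<iota> c C g A b \<delta> w_hat \<Delta> w \<longleftrightarrow>
    is_arg_min (\<lambda>v. c \<bullet> v) (\<lambda>v. v \<in> plp_feasible \<iota> C g A b \<delta> w_hat \<Delta>) w"

text \<open>
  The linear program need not be uniquely solvable in general, in which case the following value
  is meaningless; unique solvability is therefore asserted wherever the value is used.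
\<close>

definition plp_solution ::
  "('y::finite \<Rightarrow> 'w::finite) \<Rightarrow> real^'w \<Rightarrow> real^'w^'g \<Rightarrow> (real^'y \<Rightarrow> real^'g)
    \<Rightarrow> real^'w^'b \<Rightarrow> real^'b \<Rightarrow> real^'g \<Rightarrow> real^'w \<Rightarrow> real \<Rightarrow> real^'w" where
  "plp_solution \<iota> c C g A b \<delta> w_hat \<Delta> = (THE w. is_plp_solution \<iota> c C g A b \<delta> w_hat \<Delta> w)"

definition strong_regularity ::
  "('y::finite \<Rightarrow> 'w::finite) \<Rightarrow> real^'w \<Rightarrow> real^'w^'g \<Rightarrow> (real^'y \<Rightarrow> real^'g)
    \<Rightarrow> real^'w^'b \<Rightarrow> real^'b \<Rightarrow> bool" where
  "strong_regularity \<iota> c C g A b \<longleftrightarrow>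
    (\<forall>w_hat \<in> feasible_set \<iota> C g A b.
      \<exists>L1 > 0. \<exists>L2 > 0. \<exists>\<Delta>_bar > 0. \<forall>\<Delta>. 0 < \<Delta> \<and> \<Delta> \<le> \<Delta>_bar \<longrightarrow>
        (\<forall>\<delta> \<in> cball 0 (L2 * \<Delta>). \<exists>!w. is_plp_solution \<iota> c C g A b \<delta> w_hat \<Delta> w) \<and>
        (\<forall>\<delta>1 \<in> cball 0 (L2 * \<Delta>). \<forall>\<delta>2 \<in> cball 0 (L2 * \<Delta>).
          norm (plp_solution \<iota> c C g A b \<delta>1 w_hat \<Delta> - plp_solution \<iota> c C g A b \<delta>2 w_hat \<Delta>)
            \<le> L1 * norm (\<delta>1 - \<delta>2)))"

text \<open>
  Differentiability of \<open>g\<close> alone does not give a contraction rate proportional to \<open>\<Delta>\<close>: if the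
  gradient is only Hoelder continuous with exponent 1/2, the rate can be of order \<open>sqrt \<Delta>\<close>. What is
  needed is a linear bound on the variation of the gradient from its value at a single point. It
  holds in particular if the gradient is Lipschitz near that point, or differentiable at it.
  The norm of matrices is the Frobenius norm; any other norm gives the same condition.
\<close>

definition grad_lipschitz_at :: "(real^'y \<Rightarrow> real^'g) \<Rightarrow> real^'y \<Rightarrow> bool" where
  "grad_lipschitz_at g y0 \<longleftrightarrow>
    (\<exists>K. \<exists>r > 0. \<forall>y \<in> cball y0 r. norm (grad g y - grad g y0) \<le> K * norm (y - y0))"

primrec inner_iterate ::
  "('y::finite \<Rightarrow> 'w::finite) \<Rightarrow> real^'w \<Rightarrow> real^'w^'g \<Rightarrow> (real^'y \<Rightarrow> real^'g)
    \<Rightarrow> real^'w^'b \<Rightarrow> real^'b \<Rightarrow> real^'w \<Rightarrow> real \<Rightarrow> nat \<Rightarrow> real^'w" where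
  "inner_iterate \<iota> c C g A b w_hat \<Delta> 0 = plp_solution \<iota> c C g A b 0 w_hat \<Delta>"
| "inner_iterate \<iota> c C g A b w_hat \<Delta> (Suc l) =
    plp_solution \<iota> c C g A b (lin_error \<iota> g (inner_iterate \<iota> c C g A b w_hat \<Delta> l) w_hat) w_hat \<Delta>"

definition inner_iterates_well_defined ::
  "('y::finite \<Rightarrow> 'w::finite) \<Rightarrow> real^'w \<Rightarrow> real^'w^'g \<Rightarrow> (real^'y \<Rightarrow> real^'g)
    \<Rightarrow> real^'w^'b \<Rightarrow> real^'b \<Rightarrow> real^'w \<Rightarrow> real \<Rightarrow> bool" where
  "inner_iterates_well_defined \<iota> c C g A b w_hat \<Delta> \<longleftrightarrow>
    (\<exists>!w. is_plp_solution \<iota> c C g A b 0 w_hat \<Delta> w) \<and>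
    (\<forall>l. \<exists>!w. is_plp_solution \<iota> c C g A b
      (lin_error \<iota> g (inner_iterate \<iota> c C g A b w_hat \<Delta> l) w_hat) w_hat \<Delta> w)"

end

theory Submission
  imports Defs
begin

text \<open>
  The linearization error is Lipschitz on the trust region with a constant proportional to the
  radius \<open>\<Delta>\<close>, because the gradient deviates from its value at the center by
  \<open>O(\<Delta>)\<close>. Vanishing at the center, it is then of size \<open>O(\<Delta>\<^sup>2)\<close>, hence
  below \<open>L2 * \<Delta>\<close> for small \<open>\<Delta>\<close>, so that strong regularity applies to all
  iterates. The iteration map, which sends \<open>w\<close> to the solution of the linear program for the
  linearization error of \<open>w\<close>, is therefore a contraction of the trust region with rate
  \<open>L * \<Delta>\<close>. Its fixed point is feasible since at a fixed point the linearization error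
  turns the linearized equality constraint into the nonlinear one.
\<close>

text \<open>Cauchy-Schwarz in each row, then summation over the rows: the norm on the type of
  matrices is the Frobenius norm, the Euclidean norm of the vector of row norms.\<close>

lemma norm_matrix_vector_mult_le:
  fixes M :: "real^'n^'m"
  shows "norm (M *v x) \<le> norm M * norm x"
proof -
  have "norm (M *v x) \<le> L2_set (\<lambda>i. norm (M $ i) * norm x) UNIV"
    unfolding norm_vec_def[of "M *v x"]
    by (rule L2_set_mono) (simp_all add: matrix_vector_mul_component Cauchy_Schwarz_ineq2)
  also have "\<dots> = norm M * norm x"
    by (simp add: norm_vec_def[of M] L2_set_left_distrib)
  finally show ?thesis .
qed

lemma norm_transpose:
  fixes M :: "real^'n^'m"
  shows "norm (transpose M) = norm M"
  unfolding norm_eq_sqrt_inner inner_vec_def transpose_def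
  by (simp add: sum.swap[of _ "UNIV :: 'n set"])

lemma transpose_diff:
  fixes M N :: "real^'n^'m"
  shows "transpose M - transpose N = transpose (M - N)"
  by (simp add: transpose_def vec_eq_iff)

lemma lin_matrix_mult:
  "lin_matrix \<iota> g w_hat *v w = jacobian g (at (proj_y \<iota> *v w_hat)) *v (proj_y \<iota> *v w)"
  by (simp add: lin_matrix_def grad_def matrix_vector_mul_assoc)

text \<open>The mean value inequality on the convex ball, applied to \<open>g\<close> minus its
  linear part at \<open>y0\<close>. The derivative of this difference at \<open>y\<close> is the
  deviation of the Jacobian from its value at \<open>y0\<close>; its Frobenius norm is at most
  \<open>K * \<rho>\<close> and dominates the operator norm.\<close>

lemma linearization_error_lipschitz:
  fixes g :: "real^'y \<Rightarrow> real^'g"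
  assumes diff: "\<forall>y. g differentiable (at y)"
    and K: "\<forall>y \<in> cball y0 r. norm (grad g y - grad g y0) \<le> K * norm (y - y0)" "0 \<le> K"
    and \<rho>: "\<rho> \<le> r" "y1 \<in> cball y0 \<rho>" "y2 \<in> cball y0 \<rho>"
  shows "norm ((g y1 - jacobian g (at y0) *v y1) - (g y2 - jacobian g (at y0) *v y2))
    \<le> K * \<rho> * norm (y1 - y2)"
proof (rule differentiable_bound[OF convex_cball])
  fix y assume y: "y \<in> cball y0 \<rho>"
  have "(g has_derivative (*v) (jacobian g (at y))) (at y within cball y0 \<rho>)"
    using diff jacobian_works has_derivative_at_withinI by blast
  then have "((\<lambda>y. g y - jacobian g (at y0) *v y) has_derivative
      (\<lambda>h. jacobian g (at y) *v h - jacobian g (at y0) *v h)) (at y within cball y0 \<rho>)"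
    by (intro has_derivative_diff bounded_linear_imp_has_derivative
        matrix_vector_mul_bounded_linear)
  then show "((\<lambda>y. g y - jacobian g (at y0) *v y) has_derivative
      (*v) (jacobian g (at y) - jacobian g (at y0))) (at y within cball y0 \<rho>)"
    by (simp add: matrix_vector_mult_diff_rdistrib[abs_def])
  have "norm (jacobian g (at y) - jacobian g (at y0)) = norm (grad g y - grad g y0)"
    by (simp add: grad_def transpose_diff norm_transpose)
  also have "\<dots> \<le> K * norm (y - y0)"
    using K \<rho> y by auto
  also have "\<dots> \<le> K * \<rho>"
    using y K by (intro mult_left_mono) (auto simp: dist_norm norm_minus_commute)
  finally have "norm (jacobian g (at y) - jacobian g (at y0)) \<le> K * \<rho>" .
  then show "onorm ((*v) (jacobian g (at y) - jacobian g (at y0))) \<le> K * \<rho>"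
    by (intro onorm_le order_trans[OF norm_matrix_vector_mult_le] mult_right_mono) auto
qed (use \<rho> in auto)

text \<open>The only constraint kept is the one that all the linear programs share whatever their
  \<open>\<delta>\<close>, so the set can serve as an invariant domain of the iteration. It
  restricts only the non-slack coordinates.\<close>

definition trust_region ::
  "('y::finite \<Rightarrow> 'w::finite) \<Rightarrow> real^'w \<Rightarrow> real \<Rightarrow> (real^'w) set" where
  "trust_region \<iota> w_hat \<Delta> = {w. infnorm (proj_y \<iota> *v (w - w_hat)) \<le> \<Delta>}"

lemma closed_trust_region: "closed (trust_region \<iota> w_hat \<Delta>)"
  unfolding trust_region_def
  by (intro closed_Collect_le continuous_intros continuous_on_infnorm
      bounded_linear.continuous_on[OF matrix_vector_mul_bounded_linear])

lemma norm_trust_region: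
  fixes \<iota> :: "'y::finite \<Rightarrow> 'w::finite"
  assumes "w \<in> trust_region \<iota> w_hat \<Delta>"
  shows "norm (proj_y \<iota> *v (w - w_hat)) \<le> sqrt (real CARD('y)) * \<Delta>"
proof -
  have "norm (proj_y \<iota> *v (w - w_hat)) \<le> sqrt (real CARD('y)) * infnorm (proj_y \<iota> *v (w - w_hat))"
    using norm_le_infnorm[of "proj_y \<iota> *v (w - w_hat)"] by simp
  also have "\<dots> \<le> sqrt (real CARD('y)) * \<Delta>"
    using assms by (intro mult_left_mono) (simp_all add: trust_region_def)
  finally show ?thesis .
qed

text \<open>The projection maps the trust region into the Euclidean ball of radius
  \<open>sqrt (real CARD('y)) * \<Delta>\<close>, where the previous estimate applies. The constant
  terms of the two errors cancel in their difference.\<close>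

lemma lin_error_lipschitz:
  fixes g :: "real^'y \<Rightarrow> real^'g" and \<iota> :: "'y::finite \<Rightarrow> 'w::finite"
  assumes diff: "\<forall>y. g differentiable (at y)"
    and "grad_lipschitz_at g (proj_y \<iota> *v w_hat)"
  shows "\<exists>K>0. \<exists>r>0. \<forall>\<Delta>\<le>r.
    \<forall>w\<in>trust_region \<iota> w_hat \<Delta>. \<forall>w'\<in>trust_region \<iota> w_hat \<Delta>.
      norm (lin_error \<iota> g w w_hat - lin_error \<iota> g w' w_hat)
        \<le> K * \<Delta> * norm (proj_y \<iota> *v (w - w'))"
proof -
  let ?P = "proj_y \<iota>" and ?y0 = "proj_y \<iota> *v w_hat"
  define s where "s = sqrt (real CARD('y))"
  have s: "s > 0" by (simp add: s_def)
  obtain K r where "r > 0"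
    and K: "\<forall>y \<in> cball ?y0 r. norm (grad g y - grad g ?y0) \<le> K * norm (y - ?y0)"
    using assms(2) unfolding grad_lipschitz_at_def by blast
  \<comment> \<open>The given \<open>K\<close> may have any sign; the mean value estimate needs a
    nonnegative constant, and the claim a positive one.\<close>
  define K' where "K' = max K 1"
  have K': "\<forall>y \<in> cball ?y0 r. norm (grad g y - grad g ?y0) \<le> K' * norm (y - ?y0)"
    using K unfolding K'_def by (meson max.cobounded1 mult_right_mono norm_ge_zero order_trans)
  have "K' > 0" by (simp add: K'_def)
  show ?thesis
  proof (intro exI conjI allI impI ballI)
    show "K' * s > 0" "r / s > 0" using \<open>K' > 0\<close> s \<open>r > 0\<close> by simp_all
    fix \<Delta> w w'
    assume \<Delta>: "\<Delta> \<le> r / s"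
      and w: "w \<in> trust_region \<iota> w_hat \<Delta>" "w' \<in> trust_region \<iota> w_hat \<Delta>"
    have ball: "?P *v v \<in> cball ?y0 (s * \<Delta>)" if "v \<in> trust_region \<iota> w_hat \<Delta>" for v
      using norm_trust_region[OF that]
      by (simp add: s_def dist_norm norm_minus_commute matrix_vector_mult_diff_distrib)
    have "s * \<Delta> \<le> r" using \<Delta> s by (simp add: field_simps)
    from linearization_error_lipschitz[OF diff K' _ this ball[OF w(1)] ball[OF w(2)]] \<open>K' > 0\<close>
    show "norm (lin_error \<iota> g w w_hat - lin_error \<iota> g w' w_hat)
        \<le> K' * s * \<Delta> * norm (?P *v (w - w'))"
      by (simp add: lin_error_def lin_matrix_mult matrix_vector_mult_diff_distrib algebra_simps)
  qed
qed

lemma lin_error_center [simp]: "lin_error \<iota> g w_hat w_hat = 0"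
  by (simp add: lin_error_def)

lemma plp_solution_feasible:
  assumes "\<exists>!w. is_plp_solution \<iota> c C g A b \<delta> w_hat \<Delta> w"
  shows "plp_solution \<iota> c C g A b \<delta> w_hat \<Delta> \<in> plp_feasible \<iota> C g A b \<delta> w_hat \<Delta>"
  using theI'[OF assms, folded plp_solution_def]
  by (simp add: is_plp_solution_def is_arg_min_def)

lemma plp_feasible_lin_error:
  assumes "w \<in> plp_feasible \<iota> C g A b (lin_error \<iota> g w w_hat) w_hat \<Delta>"
  shows "w \<in> feasible_set \<iota> C g A b"
  using assms by (simp add: plp_feasible_def feasible_set_def lin_error_def algebra_simps)

text \<open>Complements \<open>Banach_fix\<close>, which yields the fixed point but not the
  convergence of the iterates to it.\<close>

lemma geometric_contraction_tendsto:
  fixes x :: "nat \<Rightarrow> 'a::real_normed_vector"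
  assumes "0 \<le> q" "q < 1" and step: "\<And>n. norm (x (Suc n) - a) \<le> q * norm (x n - a)"
  shows "x \<longlonglongrightarrow> a"
proof -
  have bound: "norm (x n - a) \<le> q ^ n * norm (x 0 - a)" for n
  proof (induction n)
    case (Suc n)
    have "norm (x (Suc n) - a) \<le> q * (q ^ n * norm (x 0 - a))"
      using step Suc \<open>0 \<le> q\<close> by (meson mult_left_mono order_trans)
    then show ?case by (simp add: mult.assoc)
  qed simp
  have "(\<lambda>n. q ^ n * norm (x 0 - a)) \<longlonglongrightarrow> 0"
    using assms by (intro tendsto_mult_left_zero LIMSEQ_power_zero) simp
  then have "(\<lambda>n. x n - a) \<longlonglongrightarrow> 0"
    by (rule Lim_null_comparison[rotated]) (simp add: bound)
  then show ?thesis by (simp add: LIM_zero_iff)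
qed

theorem theorem2:
  fixes \<iota> :: "'y::finite \<Rightarrow> 'w::finite"
    and c :: "real^'w"
    and C :: "real^'w^'g::finite"
    and g :: "real^'y \<Rightarrow> real^'g"
    and A :: "real^'w^'b::finite"
    and b :: "real^'b"
    and w_hat :: "real^'w"
  assumes "inj \<iota>"
    and "rank A = CARD('b)"
    and "\<forall>y. g differentiable (at y)"
    and "w_hat \<in> feasible_set \<iota> C g A b"
    and "grad_lipschitz_at g (proj_y \<iota> *v w_hat)"
    and "strong_regularity \<iota> c C g A b"
  shows "\<exists>\<Delta>_max > 0. \<exists>L > 0. \<forall>\<Delta>. 0 < \<Delta> \<and> \<Delta> \<le> \<Delta>_max \<longrightarrow>
    inner_iterates_well_defined \<iota> c C g A b w_hat \<Delta> \<and>
    (\<exists>w_star \<in> feasible_set \<iota> C g A b.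
      (\<lambda>l. inner_iterate \<iota> c C g A b w_hat \<Delta> l) \<longlonglongrightarrow> w_star \<and>
      (\<forall>l. norm (inner_iterate \<iota> c C g A b w_hat \<Delta> (Suc l) - w_star)
        \<le> L * \<Delta> * norm (inner_iterate \<iota> c C g A b w_hat \<Delta> l - w_star)))"
proof -
  let ?P = "proj_y \<iota>"
  let ?e = "\<lambda>w. lin_error \<iota> g w w_hat"
  let ?X = "trust_region \<iota> w_hat"
  obtain K r where "K > 0" "r > 0"
    and K_all: "\<forall>\<Delta>\<le>r. \<forall>w\<in>?X \<Delta>. \<forall>w'\<in>?X \<Delta>.
      norm (?e w - ?e w') \<le> K * \<Delta> * norm (?P *v (w - w'))"
    using lin_error_lipschitz[OF assms(3,5)] by (elim exE conjE)
  have K: "norm (?e w - ?e w') \<le> K * \<Delta> * norm (?P *v (w - w'))"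
    if "\<Delta> \<le> r" "w \<in> ?X \<Delta>" "w' \<in> ?X \<Delta>" for \<Delta> w w'
    using K_all that by simp
  let ?sol = "\<lambda>\<delta> \<Delta>. plp_solution \<iota> c C g A b \<delta> w_hat \<Delta>"
  obtain L1 L2 D where pos: "L1 > 0" "L2 > 0" "D > 0"
    and reg: "\<forall>\<Delta>. 0 < \<Delta> \<and> \<Delta> \<le> D \<longrightarrow>
      (\<forall>\<delta> \<in> cball 0 (L2 * \<Delta>). \<exists>!w. is_plp_solution \<iota> c C g A b \<delta> w_hat \<Delta> w) \<and>
      (\<forall>\<delta>1 \<in> cball 0 (L2 * \<Delta>). \<forall>\<delta>2 \<in> cball 0 (L2 * \<Delta>).
        norm (?sol \<delta>1 \<Delta> - ?sol \<delta>2 \<Delta>) \<le> L1 * norm (\<delta>1 - \<delta>2))"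
    using bspec[OF assms(6)[unfolded strong_regularity_def] assms(4)] by (elim exE conjE)
  have ex1: "\<exists>!w. is_plp_solution \<iota> c C g A b \<delta> w_hat \<Delta> w"
    if "0 < \<Delta>" "\<Delta> \<le> D" "norm \<delta> \<le> L2 * \<Delta>" for \<Delta> \<delta>
    using conjunct1[OF reg[rule_format, OF conjI[OF that(1,2)]]] that(3)
    unfolding mem_cball_0[symmetric] by (rule bspec)
  have lip: "norm (?sol \<delta>1 \<Delta> - ?sol \<delta>2 \<Delta>) \<le> L1 * norm (\<delta>1 - \<delta>2)"
    if "0 < \<Delta>" "\<Delta> \<le> D" "norm \<delta>1 \<le> L2 * \<Delta>" "norm \<delta>2 \<le> L2 * \<Delta>" for \<Delta> \<delta>1 \<delta>2
    using reg that by simp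
  define s where "s = sqrt (real CARD('y))"
  have s: "s > 0" by (simp add: s_def)
  \<comment> \<open>A bound on the operator norm of the projection; the summand 1 makes it visibly
    positive.\<close>
  define B where "B = norm ?P + 1"
  have "B > 0" by (simp add: B_def add_nonneg_pos)
  have B: "norm (?P *v w) \<le> B * norm w" for w
    by (rule order_trans[OF norm_matrix_vector_mult_le]) (simp add: B_def mult_right_mono)
  \<comment> \<open>\<open>L1\<close> comes from the solution map, \<open>K\<close> from the
    linearization error and \<open>B\<close> from the projection; the factor \<open>\<Delta>\<close>
    of the error is split off.\<close>
  define L where "L = L1 * (K * B)"
  have "L > 0" by (simp add: L_def pos \<open>B > 0\<close> \<open>K > 0\<close>)
  \<comment> \<open>In this order: strong regularity applies, the Lipschitz bound on the error
    applies, the errors stay in the ball of radius \<open>L2 * \<Delta>\<close>, and the rate is at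
    most 1/2.\<close>
  define \<Delta>_max where "\<Delta>_max = Min {D, r, L2 / (K * s), 1 / (2 * L)}"
  have "\<Delta>_max > 0" by (simp add: \<Delta>_max_def pos s \<open>K > 0\<close> \<open>r > 0\<close> \<open>L > 0\<close>)
  have main: "inner_iterates_well_defined \<iota> c C g A b w_hat \<Delta> \<and>
    (\<exists>w_star \<in> feasible_set \<iota> C g A b.
      (\<lambda>l. inner_iterate \<iota> c C g A b w_hat \<Delta> l) \<longlonglongrightarrow> w_star \<and>
      (\<forall>l. norm (inner_iterate \<iota> c C g A b w_hat \<Delta> (Suc l) - w_star)
        \<le> L * \<Delta> * norm (inner_iterate \<iota> c C g A b w_hat \<Delta> l - w_star)))"
    if \<Delta>: "0 < \<Delta>" "\<Delta> \<le> \<Delta>_max" for \<Delta>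
  proof -
    define S where "S \<delta> = plp_solution \<iota> c C g A b \<delta> w_hat \<Delta>" for \<delta>
    define x where "x = inner_iterate \<iota> c C g A b w_hat \<Delta>"
    have x_simps: "x 0 = S 0" "x (Suc l) = S (?e (x l))" for l by (simp_all add: x_def S_def)
    have le: "\<Delta> \<le> D" "\<Delta> \<le> r" "K * \<Delta> * s \<le> L2" "L * \<Delta> \<le> 1 / 2"
      using \<Delta> s \<open>K > 0\<close> \<open>L > 0\<close> by (simp_all add: \<Delta>_max_def field_simps)
    have "w_hat \<in> ?X \<Delta>" using \<Delta> by (simp add: trust_region_def infnorm_0)
    have S_feasible: "S \<delta> \<in> plp_feasible \<iota> C g A b \<delta> w_hat \<Delta>" if "norm \<delta> \<le> L2 * \<Delta>" for \<delta>
      unfolding S_def by (rule plp_solution_feasible[OF ex1[OF \<Delta>(1) le(1) that]])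
    then have S_X: "S \<delta> \<in> ?X \<Delta>" if "norm \<delta> \<le> L2 * \<Delta>" for \<delta>
      using that by (simp add: plp_feasible_def trust_region_def)
    \<comment> \<open>Comparison with \<open>w_hat\<close>, where the error vanishes: one factor
      \<open>\<Delta>\<close> is in the Lipschitz constant, the other bounds the distance to the
      center.\<close>
    have small: "norm (?e w) \<le> L2 * \<Delta>" if "w \<in> ?X \<Delta>" for w
    proof -
      have "K * \<Delta> * norm (?P *v (w - w_hat)) \<le> K * \<Delta> * (s * \<Delta>)"
        using norm_trust_region[OF that] \<open>K > 0\<close> \<Delta>
        by (intro mult_left_mono) (auto simp: s_def)
      also have "\<dots> \<le> L2 * \<Delta>"
        using mult_right_mono[OF le(3), of \<Delta>] \<Delta> by (simp add: mult.assoc)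
      finally show ?thesis using K[OF le(2) that \<open>w_hat \<in> ?X \<Delta>\<close>] by simp
    qed
    have contr: "norm (S (?e w) - S (?e w')) \<le> L * \<Delta> * norm (w - w')"
      if "w \<in> ?X \<Delta>" "w' \<in> ?X \<Delta>" for w w'
    proof -
      have "norm (S (?e w) - S (?e w')) \<le> L1 * norm (?e w - ?e w')"
        unfolding S_def using small that by (intro lip \<Delta> le)
      also have "\<dots> \<le> L1 * (K * \<Delta> * (B * norm (w - w')))"
      proof (rule mult_left_mono)
        have "K * \<Delta> * norm (?P *v (w - w')) \<le> K * \<Delta> * (B * norm (w - w'))"
          using \<open>K > 0\<close> \<Delta> B by (intro mult_left_mono) auto
        then show "norm (?e w - ?e w') \<le> K * \<Delta> * (B * norm (w - w'))"
          using K[OF le(2) that] by linarith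
      qed (use pos in simp)
      finally show ?thesis by (simp add: L_def mult_ac)
    qed
    \<comment> \<open>Completeness follows from closedness. The map sends the trust region into
      itself because each solution satisfies the trust region constraint of its own linear
      program.\<close>
    have "\<exists>!w\<in>?X \<Delta>. S (?e w) = w"
    proof (rule Banach_fix)
      show "complete (?X \<Delta>)"
        by (simp add: complete_eq_closed closed_trust_region)
      show "?X \<Delta> \<noteq> {}" using \<open>w_hat \<in> ?X \<Delta>\<close> by blast
      show "0 \<le> L * \<Delta>" "L * \<Delta> < 1" using \<open>L > 0\<close> \<Delta> le(4) by simp_all
      show "(\<lambda>w. S (?e w)) ` ?X \<Delta> \<subseteq> ?X \<Delta>" using small S_X by blast
      show "dist (S (?e w)) (S (?e w')) \<le> L * \<Delta> * dist w w'" if "w \<in> ?X \<Delta>" "w' \<in> ?X \<Delta>" for w w'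
        using contr[OF that] by (simp add: dist_norm)
    qed
    then obtain w_star where w_star: "w_star \<in> ?X \<Delta>" "S (?e w_star) = w_star" by blast
    have "w_star \<in> feasible_set \<iota> C g A b"
      using plp_feasible_lin_error S_feasible[OF small[OF w_star(1)]] w_star(2) by metis
    \<comment> \<open>The induction starts at \<open>S 0\<close>, since 0 is an admissible
      perturbation; after that \<open>small\<close> makes each error admissible.\<close>
    moreover have x_X: "x l \<in> ?X \<Delta>" for l
      by (induction l) (use \<Delta> pos in \<open>simp_all add: x_simps S_X small\<close>)
    then have "inner_iterates_well_defined \<iota> c C g A b w_hat \<Delta>"
      unfolding inner_iterates_well_defined_def x_def[symmetric]
      using \<Delta> pos by (intro conjI allI ex1 small le) auto
    moreover have rate: "norm (x (Suc l) - w_star) \<le> L * \<Delta> * norm (x l - w_star)" for l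
      using contr[OF x_X w_star(1)] by (simp add: x_simps w_star(2))
    moreover have "x \<longlonglongrightarrow> w_star"
      using \<open>L > 0\<close> \<Delta> le(4)
      by (intro geometric_contraction_tendsto[where q = "L * \<Delta>"] rate) simp_all
    ultimately show ?thesis unfolding x_def by blast
  qed
  show ?thesis using main \<open>\<Delta>_max > 0\<close> \<open>L > 0\<close> by blast
qed

end
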